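(* Let $n \geq 2$, let $V\ge 1$ be an integer, let $\mathcal{V} = \{\mathbf{P_1}, \ldots, \mathbf{P_V}\}$ be a multiset of $V$ points on a unit $n$-sphere in $\mathbb{R}^n$, and let $\mathcal{C}$ be the multiset of the lengths of all the chords between them (one chord for each unordered pair of indices $i<j$). Then $$\sum_{c \in \mathcal{C}} c^2 = V^2(1-d^2),$$ where $d$ is the distance between the centroid of $\mathcal{V}$ and the center of the unit $n$-sphere.
   Context: A unit $n$-sphere is the set of all points in $\mathbb{R}^n$ at Euclidean distance $1$ from a fixed point (its center); so the ambient space of the $n$-sphere is $\mathbb{R}^n$. A chord of a multiset $\mathcal{V}$ of points is a line segment whose endpoints belong to $\mathcal{V}$. For a multiset $\mathcal{V}=\{\mathbf{P_1},\ldots,\mathbf{P_V}\}$, the multiset of chord lengths is $\{\|\mathbf{P_i}-\mathbf{P_j}\| : 1\le i<j\le V\}$, counted with multiplicity, so that $\sum_{c\in\mathcal{C}} c^2=\sum_{1\le i<j\le V}\|\mathbf{P_i}-\mathbf{P_j}\|^2$. The centroid of $\mathcal{V}$ is the point $\frac{1}{V}\sum_{i=1}^V \mathbf{P_i}$ (coordinatewise average, with multiplicity). *)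

theory Defs
  imports "HOL-Analysis.Analysis" "HOL-Library.Multiset"
begin

definition centroid :: "'a::real_vector multiset \<Rightarrow> 'a" where
  "centroid M = (1 / real (size M)) *\<^sub>R sum_mset M"

(* Chords are taken over unordered pairs of indices i < j, not of distinct points,
   so coinciding points contribute chords of length 0. *)
definition chord_lengths :: "nat \<Rightarrow> (nat \<Rightarrow> 'a::metric_space) \<Rightarrow> real multiset" where
  "chord_lengths V P = {# dist (P i) (P j). (i, j) \<in># mset_set {(i, j). 1 \<le> i \<and> i < j \<and> j \<le> V} #}"

end

theory Submission
  imports Defs
begin

text \<open>
  Both sides are translation invariant, so put the center at the origin. For any vectors
  \<open>u 1, \<dots>, u V\<close> of an inner product space, expanding \<open>\<parallel>u i - u j\<parallel>\<^sup>2\<close> gives the Lagrange-type identity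
  \<open>\<Sum>\<^sub>i\<^sub><\<^sub>j \<parallel>u i - u j\<parallel>\<^sup>2 + \<parallel>\<Sum>\<^sub>i u i\<parallel>\<^sup>2 = V (\<Sum>\<^sub>i \<parallel>u i\<parallel>\<^sup>2)\<close>
  (lemma \<open>Lagrange_identity_inner\<close>). On the unit sphere the right-hand side is \<open>V\<^sup>2\<close>, while
  \<open>\<Sum>\<^sub>i u i\<close> is \<open>V\<close> times the vector from the center to the centroid
  (lemma \<open>sum_diff_eq_centroid\<close>), so its squared norm is \<open>V\<^sup>2 d\<^sup>2\<close>.
\<close>

text \<open>
  Induction on the number of vectors avoids any symmetrization of the double sum: adding a vector
  \<open>w\<close> to \<open>V\<close> vectors with sum \<open>S\<close> adds \<open>\<Sum>\<parallel>u i\<parallel>\<^sup>2 - 2 (S \<bullet> w) + V \<parallel>w\<parallel>\<^sup>2\<close> to the first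
  sum and \<open>2 (S \<bullet> w) + \<parallel>w\<parallel>\<^sup>2\<close> to the square, and the mixed terms cancel.
\<close>
lemma Lagrange_identity_inner:
  fixes u :: "nat \<Rightarrow> 'a::real_inner"
  shows "(\<Sum>j = 1..V. \<Sum>i = 1..<j. (norm (u i - u j))\<^sup>2) + (norm (\<Sum>i = 1..V. u i))\<^sup>2
           = real V * (\<Sum>i = 1..V. (norm (u i))\<^sup>2)"
proof (induction V)
  case 0
  show ?case by simp
next
  case (Suc V)
  define S where "S = (\<Sum>i = 1..V. u i)"
  define w where "w = u (Suc V)"
  have expand: "(norm (u i - w))\<^sup>2 = (norm (u i))\<^sup>2 - 2 * (u i \<bullet> w) + (norm w)\<^sup>2" for i
    by (simp add: power2_norm_eq_inner inner_diff_left inner_diff_right inner_commute)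
  have new_chords: "(\<Sum>i = 1..V. (norm (u i - w))\<^sup>2)
      = (\<Sum>i = 1..V. (norm (u i))\<^sup>2) - 2 * (S \<bullet> w) + real V * (norm w)\<^sup>2"
    unfolding expand S_def
    by (simp add: sum.distrib sum_subtractf inner_sum_left sum_distrib_left)
  have new_square: "(norm (S + w))\<^sup>2 = (norm S)\<^sup>2 + 2 * (S \<bullet> w) + (norm w)\<^sup>2"
    by (simp add: power2_norm_eq_inner inner_add_left inner_add_right inner_commute)
  have "{1..<Suc V} = {1..V}" by auto
  then show ?case
    using Suc.IH new_chords new_square unfolding S_def
    by (simp add: w_def[symmetric] algebra_simps)
qed

lemma sum_mset_chord_lengths:
  "(\<Sum>c\<in>#chord_lengths V P. f c) = (\<Sum>j = 1..V. \<Sum>i = 1..<j. f (dist (P i) (P j)))"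
proof -
  have "(\<Sum>c\<in>#chord_lengths V P. f c)
      = (\<Sum>(i, j)\<in>{(i, j). 1 \<le> i \<and> i < j \<and> j \<le> V}. f (dist (P i) (P j)))"
    by (simp add: chord_lengths_def sum_unfold_sum_mset image_mset.compositionality comp_def
        case_prod_unfold)
  also have "\<dots> = (\<Sum>(j, i)\<in>(SIGMA j:{1..V}. {1..<j}). f (dist (P i) (P j)))"
    by (rule sum.reindex_bij_witness[of _ prod.swap prod.swap]) auto
  also have "\<dots> = (\<Sum>j = 1..V. \<Sum>i = 1..<j. f (dist (P i) (P j)))"
    by (simp add: sum.Sigma)
  finally show ?thesis .
qed

lemma sum_diff_eq_centroid:
  fixes P :: "'b \<Rightarrow> 'a::real_vector"
  assumes "finite A" "A \<noteq> {}"
  shows "(\<Sum>i\<in>A. P i - a) = real (card A) *\<^sub>R (centroid {# P i. i \<in># mset_set A #} - a)"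
  using assms
  by (simp add: centroid_def sum_unfold_sum_mset[symmetric] sum_subtractf scaleR_diff_right
      sum_constant_scaleR)

theorem theorem2p1:
  fixes V :: nat
    and P :: "nat \<Rightarrow> real ^ 'n"
    and \<V> :: "(real ^ 'n) multiset"
    and center :: "real ^ 'n"
    and \<C> :: "real multiset"
    and d :: real
  assumes "CARD('n) \<ge> 2"
    and "V \<ge> 1"
    and "\<V> = {# P i. i \<in># mset_set {1..V} #}"
    and "set_mset \<V> \<subseteq> sphere center 1"
    and "\<C> = chord_lengths V P"
    and "d = dist (centroid \<V>) center"
  shows "(\<Sum>c\<in>#\<C>. c\<^sup>2) = (real V)\<^sup>2 * (1 - d\<^sup>2)"
proof -
  define u where "u i = P i - center" for i
  have "norm (u i) = 1" if "i \<in> {1..V}" for i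
    using assms(3,4) that by (force simp: u_def dist_norm norm_minus_commute)
  then have unit: "(\<Sum>i = 1..V. (norm (u i))\<^sup>2) = real V"
    by simp
  have "(\<Sum>i = 1..V. u i) = real V *\<^sub>R (centroid \<V> - center)"
    using sum_diff_eq_centroid[of "{1..V}" P center] assms(2,3) by (simp add: u_def)
  then have total: "(norm (\<Sum>i = 1..V. u i))\<^sup>2 = (real V)\<^sup>2 * d\<^sup>2"
    using assms(6) by (simp add: dist_norm power_mult_distrib)
  have "(\<Sum>c\<in>#\<C>. c\<^sup>2) = (\<Sum>j = 1..V. \<Sum>i = 1..<j. (norm (u i - u j))\<^sup>2)"
    using assms(5) by (simp add: sum_mset_chord_lengths u_def dist_norm)
  then show ?thesis
    using Lagrange_identity_inner[of u V] unit total
    by (simp add: power2_eq_square algebra_simps)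
qed

end
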